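(* Let $T:[0,1]\to[0,1]$, $T(x)=2x \bmod 1$, let $z$ be a periodic point of $T$ of (minimal) period $p$, and for each sufficiently small $\varepsilon>0$ let $I_\varepsilon\subseteq[0,1]$ be an interval of length $\varepsilon$ containing $z$. Let $\lambda_\varepsilon$ be the decay rate for the hole $I_\varepsilon$. Then $$\lambda_\varepsilon=1-\varepsilon\left(1-2^{-p}\right)+o(\varepsilon)\qquad(\varepsilon\to0).$$
   Context: The decay rate $\lambda_\varepsilon$ for the hole $I_\varepsilon$ is the exponential rate at which the Lebesgue measure $m$ of the set of points not trapped by $I_\varepsilon$ during the first $n$ iterations decreases, i.e. $\lambda_\varepsilon=\lim_{n\to\infty}m(\{x\in[0,1]:T^kx\notin I_\varepsilon\text{ for }k=0,\dots,n-1\})^{1/n}$ (for $\varepsilon$ small). *)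

theory Defs
  imports "HOL-Analysis.Analysis" "HOL-Library.Landau_Symbols"
begin

(* T x = 2x mod 1, as a map on all of \<real> that sends {0..1} into itself; T 1 = 0. *)
definition doubling_map :: "real \<Rightarrow> real" where
  "doubling_map x = frac (2 * x)"

definition has_minimal_period :: "('a \<Rightarrow> 'a) \<Rightarrow> 'a \<Rightarrow> nat \<Rightarrow> bool" where
  "has_minimal_period f z p \<longleftrightarrow>
     p > 0 \<and> (f ^^ p) z = z \<and> (\<forall>q. 0 < q \<and> q < p \<longrightarrow> (f ^^ q) z \<noteq> z)"

definition survivor_set :: "real set \<Rightarrow> nat \<Rightarrow> real set" where
  "survivor_set H n = {x \<in> {0..1}. \<forall>k<n. (doubling_map ^^ k) x \<notin> H}"

definition survival_root :: "real set \<Rightarrow> nat \<Rightarrow> real" where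
  "survival_root H n = root n (measure lebesgue (survivor_set H n))"

(* Meaningful only when survival_root H converges. *)
definition decay_rate :: "real set \<Rightarrow> real" where
  "decay_rate H = lim (survival_root H)"

end

theory Submission
  imports Defs
begin

text \<open>The mass lost in the step from time \<open>n\<close> to time \<open>n + 1\<close> is the integral over the hole \<open>H\<close> of the
  density of the surviving mass at time \<open>n\<close>. The proof shows that on the hole this density is close to
  $1 - 2^{-p}$ times the total surviving mass, for all large \<open>n\<close>, once the hole is small. Each step then
  multiplies the mass by $1 - \varepsilon (1 - 2^{-p}) + o(\varepsilon)$.

  The density at \<open>x\<close> is $2^{-n}$ times the number of inverse branches of the \<open>n\<close>-th iterate whose orbit over
  \<open>x\<close> avoids the hole. Two of its values are compared by counting branches that avoid the hole over
  \<open>x\<close> and hit it over \<open>y\<close>, sorted by the time \<open>l\<close> elapsed since the last hit. Since \<open>H\<close> is an interval,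
  there is at most one branch of length \<open>l\<close> that separates \<open>x\<close> from \<open>y\<close>, so the difference of the
  densities is at most a sum of terms $2^{-l}$ times the supremum at time \<open>n - l\<close>, over those \<open>l\<close> for
  which \<open>y\<close> can be reached from the hole in \<open>l\<close> steps (\<open>survivor_density_comparison\<close>).

  Most points cannot be reached within a fixed number of steps from a small hole. Comparison with
  them shows that the supremum of the density is at most \<open>C\<close> times its average, the mass, with \<open>C\<close>
  as close to 1 as desired (\<open>dominated_all\<close>). This makes the masses submultiplicative up to a
  constant, so that Fekete's lemma gives the existence of the decay rate.

  A point \<open>y\<close> of the hole, on the other hand, is reached from the hole in few steps, without a
  visit to the hole in between, only along the branch of length \<open>p\<close> that fixes \<open>z\<close> (\<open>entry_near_periodic_point\<close>). Over \<open>y\<close> this branch always starts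
  in the hole, so a proportion close to $2^{-p}$ is lost, and hits that lie further back carry weights
  $2^{-l}$ with \<open>l\<close> large. The two resulting bounds are \<open>survivor_density_on_hole\<close>.\<close>

section \<open>Inverse branches and the density of the surviving mass\<close>

text \<open>The inverse branches of the $l$-th iterate are indexed by $i < 2^l$; the binary digits of \<open>i\<close> are the
  itinerary, and reducing \<open>j < 2^n\<close> modulo $2^l$ keeps its last \<open>l\<close> steps, because applying the map
  drops the leading digit.\<close>

definition branch :: "nat \<Rightarrow> nat \<Rightarrow> real \<Rightarrow> real" where
  "branch l i x = (x + real i) / 2 ^ l"

text \<open>The iterates of \<open>branch n j x\<close> at times \<open>0, \<dots>, n - 1\<close> are listed backwards in time: the index
  \<open>l\<close> is the number of steps left before \<open>x\<close> is reached.\<close>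

definition avoids :: "real set \<Rightarrow> nat \<Rightarrow> real \<Rightarrow> nat \<Rightarrow> bool" where
  "avoids H n x j \<longleftrightarrow> (\<forall>l\<in>{1..n}. branch l (j mod 2 ^ l) x \<notin> H)"

definition avoiding_branches :: "real set \<Rightarrow> nat \<Rightarrow> real \<Rightarrow> nat set" where
  "avoiding_branches H n x = {j. j < 2 ^ n \<and> avoids H n x j}"

text \<open>This is the \<open>n\<close>-th iterate, applied to the constant 1, of the transfer operator of the open
  system: the density of the image under the \<open>n\<close>-th iterate of Lebesgue measure on the survivors.\<close>

definition survivor_density :: "real set \<Rightarrow> nat \<Rightarrow> real \<Rightarrow> real" where
  "survivor_density H n x = real (card (avoiding_branches H n x)) / 2 ^ n"

text \<open>The point 1 is removed because the inverse branches only reach $[0,1)$.\<close>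

definition survivors :: "real set \<Rightarrow> nat \<Rightarrow> real set" where
  "survivors H n = {x \<in> {0..<1}. \<forall>k<n. (doubling_map ^^ k) x \<notin> H}"

definition mass :: "real set \<Rightarrow> nat \<Rightarrow> real" where
  "mass H n = measure lborel (survivors H n)"

lemma branch_in_unit:
  assumes "x \<in> {0..<1}" "i < 2 ^ l"
  shows "branch l i x \<in> {0..<1}"
proof -
  have "real i + 1 \<le> 2 ^ l"
    using assms(2) by (metis Suc_eq_plus1 Suc_leI of_nat_1 of_nat_add of_nat_le_iff of_nat_numeral of_nat_power)
  then show ?thesis
    using assms(1) by (auto simp: branch_def divide_simps)
qed

lemma branch_branch: "branch r j (branch l i x) = branch (l + r) (i + 2 ^ l * j) x"
  by (simp add: branch_def power_add field_simps)

lemma funpow_doubling_map: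
  assumes "x \<in> {0..<1}"
  shows "(doubling_map ^^ k) x = frac (2 ^ k * x)"
proof (induction k)
  case 0
  then show ?case using assms by (simp add: frac_eq)
next
  case (Suc k)
  have "frac (2 * frac (2 ^ k * x)) = frac (2 ^ Suc k * x)"
    unfolding frac_unique_iff
  proof (intro conjI)
    have "2 * frac (2 ^ k * x) - frac (2 ^ Suc k * x)
        = of_int (\<lfloor>2 ^ Suc k * x\<rfloor> - 2 * \<lfloor>2 ^ k * x\<rfloor>)"
      by (simp add: frac_def algebra_simps)
    then show "2 * frac (2 ^ k * x) - frac (2 ^ Suc k * x) \<in> \<int>"
      by (metis Ints_of_int)
  qed (auto simp: frac_lt_1)
  then show ?case using Suc by (simp add: doubling_map_def)
qed

lemma funpow_branch:
  assumes "x \<in> {0..<1}" "j < 2 ^ n" "k \<le> n"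
  shows "(doubling_map ^^ k) (branch n j x) = branch (n - k) (j mod 2 ^ (n - k)) x"
proof -
  let ?m = "n - k"
  have "real j = real (j mod 2 ^ ?m) + 2 ^ ?m * real (j div 2 ^ ?m)"
  proof -
    have "real j = real (j mod 2 ^ ?m + 2 ^ ?m * (j div 2 ^ ?m))" by simp
    then show ?thesis by (simp only: of_nat_add of_nat_mult of_nat_power of_nat_numeral)
  qed
  moreover have "(2::real) ^ n = 2 ^ k * 2 ^ ?m"
    using assms(3) by (metis le_add_diff_inverse power_add)
  ultimately have "2 ^ k * branch n j x = branch ?m (j mod 2 ^ ?m) x + real (j div 2 ^ ?m)"
    by (simp add: branch_def field_simps)
  moreover have "branch ?m (j mod 2 ^ ?m) x \<in> {0..<1}"
    by (rule branch_in_unit[OF assms(1)]) simp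
  ultimately have "frac (2 ^ k * branch n j x) = branch ?m (j mod 2 ^ ?m) x"
    by (auto simp: frac_unique_iff)
  then show ?thesis
    using funpow_doubling_map branch_in_unit[OF assms(1,2)] by simp
qed

lemma branch_in_survivors_iff:
  assumes "x \<in> {0..<1}" "j < 2 ^ n"
  shows "branch n j x \<in> survivors H n \<longleftrightarrow> avoids H n x j"
proof
  assume *: "branch n j x \<in> survivors H n"
  show "avoids H n x j"
    unfolding avoids_def
  proof
    fix l assume l: "l \<in> {1..n}"
    then have "(doubling_map ^^ (n - l)) (branch n j x) \<notin> H"
      using * by (auto simp: survivors_def)
    then show "branch l (j mod 2 ^ l) x \<notin> H"
      using funpow_branch[OF assms, of "n - l"] l by simp
  qed
next
  assume *: "avoids H n x j"
  have "(doubling_map ^^ k) (branch n j x) \<notin> H" if "k < n" for k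
    using * funpow_branch[OF assms, of k] that by (auto simp: avoids_def)
  then show "branch n j x \<in> survivors H n"
    using branch_in_unit[OF assms] by (simp add: survivors_def)
qed

lemma avoids_split:
  assumes "i < 2 ^ l"
  shows "avoids H (l + r) x (i + 2 ^ l * j) \<longleftrightarrow> avoids H l x i \<and> avoids H r (branch l i x) j"
proof -
  have low: "(i + 2 ^ l * j) mod 2 ^ m = i mod 2 ^ m" if "m \<le> l" for m
  proof -
    have "(2::nat) ^ m dvd 2 ^ l * j" using that by (simp add: le_imp_power_dvd)
    then show ?thesis by (metis mod_add_right_eq add_0_right dvd_eq_mod_eq_0)
  qed
  have high: "(i + 2 ^ l * j) mod 2 ^ (l + m) = i + 2 ^ l * (j mod 2 ^ m)" for m
  proof -
    have "(i + 2 ^ l * j) mod (2 ^ l * 2 ^ m)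
        = 2 ^ l * ((i + 2 ^ l * j) div 2 ^ l mod 2 ^ m) + (i + 2 ^ l * j) mod 2 ^ l"
      by (rule mod_mult2_eq)
    then show ?thesis using assms by (simp add: power_add)
  qed
  have "avoids H (l + r) x (i + 2 ^ l * j) \<longleftrightarrow>
      (\<forall>m\<in>{1..l}. branch m ((i + 2 ^ l * j) mod 2 ^ m) x \<notin> H) \<and>
      (\<forall>m\<in>{1..r}. branch (l + m) ((i + 2 ^ l * j) mod 2 ^ (l + m)) x \<notin> H)"
  proof -
    have "{1..l + r} = {1..l} \<union> (+) l ` {1..r}"
      by (auto simp: image_iff)
    then show ?thesis
      unfolding avoids_def by (simp only: ball_Un ball_simps)
  qed
  also have "\<dots> \<longleftrightarrow> avoids H l x i \<and> avoids H r (branch l i x) j"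
    unfolding avoids_def by (auto simp: low high branch_branch)
  finally show ?thesis .
qed

lemma card_avoiding_fibre_le:
  assumes "i < 2 ^ l"
  shows "card {j \<in> avoiding_branches H (l + r) x. j mod 2 ^ l = i} \<le> card (avoiding_branches H r (branch l i x))"
proof (rule card_inj_on_le[where f = "\<lambda>j. j div 2 ^ l"])
  show "inj_on (\<lambda>j. j div 2 ^ l) {j \<in> avoiding_branches H (l + r) x. j mod 2 ^ l = i}"
    by (rule inj_onI) (metis (mono_tags, lifting) mem_Collect_eq mod_mult_div_eq)
  show "finite (avoiding_branches H r (branch l i x))"
    by (simp add: avoiding_branches_def)
  show "(\<lambda>j. j div 2 ^ l) ` {j \<in> avoiding_branches H (l + r) x. j mod 2 ^ l = i}
      \<subseteq> avoiding_branches H r (branch l i x)"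
  proof safe
    fix j assume j: "j \<in> avoiding_branches H (l + r) x" "i = j mod 2 ^ l"
    have "j = i + 2 ^ l * (j div 2 ^ l)" using j(2) by simp
    moreover have "j div 2 ^ l < 2 ^ r"
      using j(1) by (simp add: avoiding_branches_def power_add less_mult_imp_div_less mult.commute)
    ultimately show "j div 2 ^ l \<in> avoiding_branches H r (branch l (j mod 2 ^ l) x)"
      using j avoids_split[OF assms, of H r x "j div 2 ^ l"] by (simp add: avoiding_branches_def)
  qed
qed

text \<open>Choosing the last \<open>l\<close> steps of a backward itinerary within \<open>J\<close> leaves \<open>card J\<close> starting points for
  the remaining \<open>r\<close> steps, and each of them is counted by the density at time \<open>r\<close>.\<close>

lemma card_avoiding_restricted_le:
  assumes "J \<subseteq> {..<2 ^ l}" "x \<in> {0..<1}"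
    and M: "\<And>u. u \<in> {0..<1} \<Longrightarrow> survivor_density H r u \<le> M"
  shows "real (card {j \<in> avoiding_branches H (l + r) x. j mod 2 ^ l \<in> J}) \<le> real (card J) * (2 ^ r * M)"
proof -
  have fin: "finite J" using assms(1) finite_subset by blast
  have "{j \<in> avoiding_branches H (l + r) x. j mod 2 ^ l \<in> J}
      = (\<Union>i\<in>J. {j \<in> avoiding_branches H (l + r) x. j mod 2 ^ l = i})" by blast
  then have "card {j \<in> avoiding_branches H (l + r) x. j mod 2 ^ l \<in> J}
      \<le> (\<Sum>i\<in>J. card {j \<in> avoiding_branches H (l + r) x. j mod 2 ^ l = i})"
    using card_UN_le[OF fin] by simp
  also have "\<dots> \<le> (\<Sum>i\<in>J. card (avoiding_branches H r (branch l i x)))"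
    using assms(1) by (intro sum_mono card_avoiding_fibre_le) auto
  finally have "real (card {j \<in> avoiding_branches H (l + r) x. j mod 2 ^ l \<in> J})
      \<le> (\<Sum>i\<in>J. real (card (avoiding_branches H r (branch l i x))))"
    unfolding of_nat_sum[symmetric] of_nat_le_iff .
  also have "\<dots> \<le> (\<Sum>i\<in>J. 2 ^ r * M)"
  proof (rule sum_mono)
    fix i assume "i \<in> J"
    then have "survivor_density H r (branch l i x) \<le> M"
      using assms(1) by (intro M branch_in_unit[OF assms(2)]) auto
    then show "real (card (avoiding_branches H r (branch l i x))) \<le> 2 ^ r * M"
      by (simp add: survivor_density_def field_simps)
  qed
  finally show ?thesis by simp
qed

text \<open>These itineraries lead from the hole to \<open>y\<close> in \<open>l\<close> steps without meeting the hole in between.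
  Asking for this absence of intermediate visits is what later makes only the return time \<open>p\<close>
  matter, and not its multiples.\<close>

definition entry_branches :: "real set \<Rightarrow> nat \<Rightarrow> real \<Rightarrow> nat set" where
  "entry_branches H l y =
     {i. i < 2 ^ l \<and> branch l i y \<in> H \<and> (\<forall>m\<in>{1..<l}. branch m (i mod 2 ^ m) y \<notin> H)}"

text \<open>The points \<open>branch l i x\<close> and \<open>branch l i y\<close> are the end points of disjoint intervals, which are
  ordered by \<open>i\<close>. Two separating indices would put a point outside the hole between two points of
  the hole, against convexity.\<close>

lemma card_separating_branches_le_1:
  assumes H: "is_interval H" and xy: "x \<in> {0..<1}" "y \<in> {0..<1}"
  shows "card {i. i < 2 ^ l \<and> branch l i y \<in> H \<and> branch l i x \<notin> H} \<le> 1"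
proof -
  have no: False if "i < i'" and i: "branch l i y \<in> H" "branch l i x \<notin> H"
    and i': "branch l i' y \<in> H" "branch l i' x \<notin> H" for i i'
  proof -
    have *: "real i + 1 \<le> real i'" using that(1) by linarith
    have mem: "w \<in> H" if "branch l i y \<le> w" "w \<le> branch l i' y" for w
      using H i(1) i'(1) that unfolding is_interval_1 by blast
    show False
    proof (cases "x \<le> y")
      case True
      have "branch l i' x \<in> H"
        using True * xy by (intro mem) (auto simp: branch_def divide_simps)
      then show False using i' by simp
    next
      case False
      have "branch l i x \<in> H"
        using False * xy by (intro mem) (auto simp: branch_def divide_simps)
      then show False using i by simp
    qed
  qed
  show ?thesis
    by (subst card_le_Suc0_iff_eq[simplified One_nat_def[symmetric]])
      (use no in \<open>auto, metis linorder_neqE_nat\<close>)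
qed

text \<open>Branches that avoid the hole over \<open>x\<close> but not over \<open>y\<close> are sorted by the last visit of the
  \<open>y\<close>-orbit to the hole. If that visit happens \<open>l\<close> steps before the end, at most one choice of the
  last \<open>l\<close> steps is possible, and the earlier part of the itinerary is counted by the density at
  time \<open>n - l\<close>.\<close>

lemma survivor_density_comparison:
  assumes H: "is_interval H" and xy: "x \<in> {0..<1}" "y \<in> {0..<1}"
    and M: "\<And>k u. k < n \<Longrightarrow> u \<in> {0..<1} \<Longrightarrow> survivor_density H k u \<le> M k"
  shows "survivor_density H n x
      \<le> survivor_density H n y + (\<Sum>l | l \<in> {1..n} \<and> entry_branches H l y \<noteq> {}. M (n - l) / 2 ^ l)"
proof -
  define R where "R = {l. l \<in> {1..n} \<and> entry_branches H l y \<noteq> {}}"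
  define J where "J l = {i \<in> entry_branches H l y. branch l i x \<notin> H}" for l
  define G where "G l = {j \<in> avoiding_branches H n x. j mod 2 ^ l \<in> J l}" for l
  have finR: "finite R" by (simp add: R_def)
  have finG: "finite (avoiding_branches H n w)" for w by (simp add: avoiding_branches_def)
  have sub: "avoiding_branches H n x \<subseteq> avoiding_branches H n y \<union> (\<Union>l\<in>R. G l)"
  proof
    fix j assume j: "j \<in> avoiding_branches H n x"
    show "j \<in> avoiding_branches H n y \<union> (\<Union>l\<in>R. G l)"
    proof (cases "avoids H n y j")
      case True
      then show ?thesis using j by (simp add: avoiding_branches_def)
    next
      case False
      \<comment> \<open>the least number of remaining steps is the last visit in time\<close>
      define l where "l = (LEAST l. l \<in> {1..n} \<and> branch l (j mod 2 ^ l) y \<in> H)"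
      have ex: "\<exists>l. l \<in> {1..n} \<and> branch l (j mod 2 ^ l) y \<in> H"
        using False unfolding avoids_def by blast
      have l: "l \<in> {1..n}" "branch l (j mod 2 ^ l) y \<in> H"
        using LeastI_ex[OF ex] unfolding l_def by auto
      have "branch m (j mod 2 ^ m) y \<notin> H" if "m \<in> {1..<l}" for m
        using not_less_Least[of m "\<lambda>l. l \<in> {1..n} \<and> branch l (j mod 2 ^ l) y \<in> H"] that l(1)
        unfolding l_def by auto
      moreover have "j mod 2 ^ l mod 2 ^ m = j mod 2 ^ m" if "m \<in> {1..<l}" for m
        using that by (intro mod_mod_cancel le_imp_power_dvd) auto
      ultimately have "j mod 2 ^ l \<in> entry_branches H l y"
        using l by (simp add: entry_branches_def)
      moreover have "branch l (j mod 2 ^ l) x \<notin> H"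
        using j l(1) by (auto simp: avoiding_branches_def avoids_def)
      ultimately have "j \<in> G l" "l \<in> R"
        using j l by (auto simp: G_def J_def R_def)
      then show ?thesis by blast
    qed
  qed
  have G: "real (card (G l)) \<le> 2 ^ n * (M (n - l) / 2 ^ l)" if "l \<in> R" for l
  proof -
    have l: "l \<in> {1..n}" using that by (simp add: R_def)
    have "card (J l) \<le> card {i. i < 2 ^ l \<and> branch l i y \<in> H \<and> branch l i x \<notin> H}"
      by (rule card_mono) (auto simp: J_def entry_branches_def)
    then have cJ: "card (J l) \<le> 1"
      using card_separating_branches_le_1[OF H xy, of l] by simp
    have Ml: "survivor_density H (n - l) u \<le> M (n - l)" if "u \<in> {0..<1}" for u
      using M[of "n - l" u] l that by auto
    have pos: "0 \<le> M (n - l)"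
      using Ml[of 0] by (simp add: survivor_density_def) (smt (verit) divide_nonneg_nonneg of_nat_0_le_iff zero_le_power)
    have "real (card (G l)) \<le> real (card (J l)) * (2 ^ (n - l) * M (n - l))"
      using card_avoiding_restricted_le[of "J l" l x H "n - l" "M (n - l)"] xy(1) Ml l
      by (auto simp: G_def J_def entry_branches_def)
    also have "\<dots> \<le> 1 * (2 ^ (n - l) * M (n - l))"
      using cJ pos by (intro mult_right_mono) auto
    also have "\<dots> = 2 ^ n * (M (n - l) / 2 ^ l)"
      using l by (simp add: power_diff)
    finally show ?thesis .
  qed
  have "card (avoiding_branches H n x) \<le> card (avoiding_branches H n y \<union> (\<Union>l\<in>R. G l))"
    using sub finG finR by (intro card_mono) (auto simp: G_def)
  also have "\<dots> \<le> card (avoiding_branches H n y) + (\<Sum>l\<in>R. card (G l))"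
    by (rule order_trans[OF card_Un_le add_left_mono[OF card_UN_le[OF finR]]])
  finally have "real (card (avoiding_branches H n x))
      \<le> real (card (avoiding_branches H n y)) + (\<Sum>l\<in>R. real (card (G l)))"
    unfolding of_nat_sum[symmetric] of_nat_add[symmetric] of_nat_le_iff .
  also have "\<dots> \<le> real (card (avoiding_branches H n y)) + (\<Sum>l\<in>R. 2 ^ n * (M (n - l) / 2 ^ l))"
    using G by (intro add_left_mono sum_mono) auto
  also have "\<dots> = 2 ^ n * (survivor_density H n y + (\<Sum>l\<in>R. M (n - l) / 2 ^ l))"
    by (simp add: survivor_density_def sum_distrib_left distrib_left)
  finally have "survivor_density H n x \<le> survivor_density H n y + (\<Sum>l\<in>R. M (n - l) / 2 ^ l)"
    by (simp add: survivor_density_def divide_le_eq mult.commute)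
  then show ?thesis by (simp add: R_def)
qed

text \<open>A branch whose last \<open>p\<close> steps start in the hole contributes nothing. This is where the factor
  $1 - 2^{-p}$ comes from.\<close>

lemma survivor_density_le_omitting_branch:
  assumes "x \<in> {0..<1}" "p \<le> n" "i < 2 ^ p" "branch p i x \<in> H" "0 < p"
    and M: "\<And>u. u \<in> {0..<1} \<Longrightarrow> survivor_density H (n - p) u \<le> M"
  shows "survivor_density H n x \<le> (1 - 1 / 2 ^ p) * M"
proof -
  let ?J = "{..<2 ^ p} - {i}"
  have "avoiding_branches H n x = {j \<in> avoiding_branches H (p + (n - p)) x. j mod 2 ^ p \<in> ?J}"
    using assms(2,4,5) by (auto simp: avoiding_branches_def avoids_def)
  then have "real (card (avoiding_branches H n x)) \<le> real (card ?J) * (2 ^ (n - p) * M)"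
    using card_avoiding_restricted_le[of ?J p x H "n - p" M] assms(1) M by auto
  also have "real (card ?J) = 2 ^ p - 1"
    using assms(3) by (simp add: of_nat_diff)
  also have "(2 ^ p - 1) * (2 ^ (n - p) * M) = 2 ^ n * ((1 - 1 / 2 ^ p) * M)"
    using assms(2) by (simp add: power_diff field_simps)
  finally show ?thesis by (simp add: survivor_density_def field_simps)
qed

section \<open>Measures of arriving sets\<close>

lemma affine_vimage_borel:
  fixes A :: "real set"
  assumes "A \<in> sets borel"
  shows "{x. t + c * x \<in> A} \<in> sets borel"
proof -
  have "(\<lambda>x. t + c * x) -` A \<inter> space borel \<in> sets borel"
    using assms by (intro measurable_sets[where A = borel]) auto
  then show ?thesis by (simp add: vimage_def)
qed

lemma measure_lborel_affine_vimage:
  fixes A :: "real set"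
  assumes "A \<in> sets borel" "c \<noteq> 0"
  shows "measure lborel {x. t + c * x \<in> A} = measure lborel A / \<bar>c\<bar>"
proof -
  have "(\<integral>\<^sup>+x. indicator A x \<partial>lborel) = ennreal \<bar>c\<bar> * (\<integral>\<^sup>+x. indicator A (t + c * x) \<partial>lborel)"
    using assms by (intro nn_integral_real_affine) auto
  also have "(\<lambda>x. indicator A (t + c * x)) = (indicator {x. t + c * x \<in> A} :: real \<Rightarrow> ennreal)"
    by (auto simp: indicator_def)
  also have "(\<integral>\<^sup>+x. indicator {x. t + c * x \<in> A} x \<partial>lborel) = emeasure lborel {x. t + c * x \<in> A}"
    using affine_vimage_borel[OF assms(1)] by (intro nn_integral_indicator) simp
  finally have "emeasure lborel A = ennreal \<bar>c\<bar> * emeasure lborel {x. t + c * x \<in> A}"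
    using assms(1) by simp
  then have "measure lborel A = \<bar>c\<bar> * measure lborel {x. t + c * x \<in> A}"
    by (simp add: measure_def enn2real_mult)
  then show ?thesis using assms(2) by simp
qed

lemma avoids_set_borel:
  assumes "H \<in> sets borel"
  shows "{x. avoids H n x j} \<in> sets borel"
proof -
  have "{x. branch l i x \<notin> H} \<in> sets borel" for l i
  proof -
    have "{x. branch l i x \<notin> H} = {x. real i / 2 ^ l + (1 / 2 ^ l) * x \<in> - H}"
      by (auto simp: branch_def add_divide_distrib add.commute)
    then show ?thesis using affine_vimage_borel[of "- H"] assms by auto
  qed
  then have "(\<Inter>l\<in>{1..n}. {x. branch l (j mod 2 ^ l) x \<notin> H}) \<in> sets borel"
    by (cases "n = 0") (auto intro!: sets.finite_INT)
  moreover have "{x. avoids H n x j} = (\<Inter>l\<in>{1..n}. {x. branch l (j mod 2 ^ l) x \<notin> H})"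
    by (auto simp: avoids_def)
  ultimately show ?thesis by simp
qed

text \<open>All masses of survivors are read off from this set: with \<open>A\<close> the unit interval it gives the
  survivors at time \<open>n\<close>, with \<open>A\<close> the survivors at time \<open>m\<close> those at time \<open>n + m\<close>, and with \<open>A\<close> the
  hole those lost at the next step.\<close>

definition arriving :: "real set \<Rightarrow> nat \<Rightarrow> real set \<Rightarrow> real set" where
  "arriving H n A = {u \<in> survivors H n. (doubling_map ^^ n) u \<in> A}"

lemma arriving_eq_UN:
  assumes "A \<subseteq> {0..<1}"
  shows "arriving H n A = (\<Union>j<2 ^ n. {u. - real j + 2 ^ n * u \<in> {x \<in> A. avoids H n x j}})"
proof (intro set_eqI iffI)
  fix u assume u: "u \<in> arriving H n A"
  define j where "j = nat \<lfloor>2 ^ n * u\<rfloor>"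
  have u01: "0 \<le> u" "u < 1" using u by (auto simp: arriving_def survivors_def)
  have jr: "real j = of_int \<lfloor>2 ^ n * u\<rfloor>" using u01 by (simp add: j_def)
  have "real j < 2 ^ n" unfolding jr using u01
    by (smt (verit) mult_left_le of_int_floor_le zero_less_power mult_less_cancel_left2)
  then have j: "j < 2 ^ n" by (metis of_nat_less_iff of_nat_numeral of_nat_power)
  define x where "x = frac (2 ^ n * u)"
  have x: "x = - real j + 2 ^ n * u" by (simp add: x_def frac_def jr)
  have x01: "x \<in> {0..<1}" by (simp add: x_def frac_lt_1)
  have ub: "u = branch n j x" by (simp add: x branch_def)
  have "x \<in> A" using u funpow_doubling_map[of u n] u01 by (simp add: x_def arriving_def)
  moreover have "avoids H n x j"
    using branch_in_survivors_iff[OF x01 j, of H] u by (simp add: ub[symmetric] arriving_def)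
  ultimately show "u \<in> (\<Union>j<2 ^ n. {u. - real j + 2 ^ n * u \<in> {x \<in> A. avoids H n x j}})"
    using j x by auto
next
  fix u assume "u \<in> (\<Union>j<2 ^ n. {u. - real j + 2 ^ n * u \<in> {x \<in> A. avoids H n x j}})"
  then obtain j where j: "j < 2 ^ n" "- real j + 2 ^ n * u \<in> A" "avoids H n (- real j + 2 ^ n * u) j"
    by auto
  define x where "x = - real j + 2 ^ n * u"
  have ub: "u = branch n j x" by (simp add: x_def branch_def)
  have x: "x \<in> A" "x \<in> {0..<1}" using j(2) assms by (auto simp: x_def)
  have "(doubling_map ^^ n) u = x"
    unfolding ub using funpow_branch[OF x(2) j(1), of n] by (simp add: branch_def)
  moreover have "u \<in> survivors H n"
    unfolding ub using branch_in_survivors_iff[OF x(2) j(1)] j(3) by (simp add: x_def)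
  ultimately show "u \<in> arriving H n A" using x by (simp add: arriving_def)
qed

lemma arriving_borel:
  assumes "A \<subseteq> {0..<1}" "A \<in> sets borel" "H \<in> sets borel"
  shows "arriving H n A \<in> sets borel"
  unfolding arriving_eq_UN[OF assms(1)]
proof (intro sets.finite_UN affine_vimage_borel)
  fix j
  have "{x \<in> A. avoids H n x j} = A \<inter> {x. avoids H n x j}" by auto
  then show "{x \<in> A. avoids H n x j} \<in> sets borel"
    using avoids_set_borel[OF assms(3), of n j] assms(2) by auto
qed simp

lemma fmeasurable_unit_subset:
  "A \<subseteq> {0..<1} \<Longrightarrow> A \<in> sets borel \<Longrightarrow> A \<in> fmeasurable lborel" for A :: "real set"
  by (rule fmeasurableI2[of "{0..1}"]) (auto intro: fmeasurableI)

text \<open>The change of variables on each of the $2^n$ inverse branches contracts by $2^{-n}$, and the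
  indicators of the branches add up to the survivor density.\<close>

lemma measure_arriving:
  assumes A: "A \<subseteq> {0..<1}" "A \<in> sets borel" and H: "H \<in> sets borel"
  shows "set_integrable lborel A (survivor_density H n)"
    and "measure lborel (arriving H n A) = (LINT x:A|lborel. survivor_density H n x)"
proof -
  define G where "G j = {x \<in> A. avoids H n x j}" for j
  define X where "X j = {u. - real j + 2 ^ n * u \<in> G j}" for j
  have G: "G j \<in> sets borel" "G j \<subseteq> {0..<1}" for j
  proof -
    have "G j = A \<inter> {x. avoids H n x j}" by (auto simp: G_def)
    then show "G j \<in> sets borel"
      using avoids_set_borel[OF H, of n j] A(2) by auto
    show "G j \<subseteq> {0..<1}" using A by (auto simp: G_def)
  qed
  have Gf: "G j \<in> fmeasurable lborel" for j
    using G by (intro fmeasurable_unit_subset)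
  have X: "X j \<in> sets borel" for j
    unfolding X_def by (intro affine_vimage_borel G)
  have Xs: "X j \<subseteq> {0..<1}" if "j < 2 ^ n" for j
  proof
    fix u assume "u \<in> X j"
    then have x: "- real j + 2 ^ n * u \<in> {0..<1}" (is "?x \<in> _") using G(2)[of j] unfolding X_def by blast
    have "branch n j ?x = u" by (simp add: branch_def)
    then show "u \<in> {0..<1}" using branch_in_unit[OF x that] by simp
  qed
  have disj: "disjoint_family_on X {..<2 ^ n}"
    unfolding disjoint_family_on_def
  proof (intro ballI impI)
    fix i j :: nat assume "i \<noteq> j"
    { fix u assume "u \<in> X i" "u \<in> X j"
      then have "- real i + 2 ^ n * u \<in> {0..<1}" "- real j + 2 ^ n * u \<in> {0..<1}"
        using G(2)[of i] G(2)[of j] unfolding X_def by blast+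
      then have "\<bar>real i - real j\<bar> < 1" by auto
      then have False using \<open>i \<noteq> j\<close> by linarith }
    then show "X i \<inter> X j = {}" by blast
  qed
  have ind: "indicator A x *\<^sub>R survivor_density H n x = (\<Sum>j<2 ^ n. indicator (G j) x) / 2 ^ n" for x
  proof (cases "x \<in> A")
    case True
    then have "(\<Sum>j<2 ^ n. indicator (G j) x :: real) = (\<Sum>j<2 ^ n. if avoids H n x j then 1 else 0)"
      by (intro sum.cong) (auto simp: G_def)
    also have "\<dots> = real (card (avoiding_branches H n x))"
      by (simp add: sum.If_cases avoiding_branches_def Int_def)
    finally show ?thesis using True by (simp add: survivor_density_def)
  qed (simp add: G_def)
  have int: "integrable lborel (indicator (G j) :: real \<Rightarrow> real)" for j
    using Gf[of j] by (auto simp: fmeasurable_def)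
  show "set_integrable lborel A (survivor_density H n)"
    unfolding set_integrable_def ind by (intro integrable_divide Bochner_Integration.integrable_sum int)
  have "arriving H n A = (\<Union>j<2 ^ n. X j)"
    unfolding arriving_eq_UN[OF A(1)] X_def G_def by simp
  then have "measure lborel (arriving H n A) = (\<Sum>j<2 ^ n. measure lborel (X j))"
    using measure_finite_Union[of "{..<2 ^ n}" X lborel] X disj Xs fmeasurable_unit_subset
    by (auto simp: fmeasurable_def less_top[symmetric])
  also have "\<dots> = (\<Sum>j<2 ^ n. measure lborel (G j) / 2 ^ n)"
  proof (rule sum.cong)
    show "measure lborel (X j) = measure lborel (G j) / 2 ^ n" for j
      unfolding X_def using measure_lborel_affine_vimage[OF G(1)[of j], of "2 ^ n" "- real j"] by simp
  qed simp
  also have "\<dots> = (\<Sum>j<2 ^ n. (LINT x|lborel. indicator (G j) x)) / 2 ^ n"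
    by (simp add: sum_divide_distrib)
  also have "\<dots> = (LINT x|lborel. (\<Sum>j<2 ^ n. indicator (G j) x) / 2 ^ n)"
    using int by (simp add: Bochner_Integration.integral_sum)
  also have "\<dots> = (LINT x:A|lborel. survivor_density H n x)"
    unfolding set_lebesgue_integral_def ind ..
  finally show "measure lborel (arriving H n A) = (LINT x:A|lborel. survivor_density H n x)" .
qed

lemma set_integral_const_bound:
  fixes A :: "real set"
  assumes "A \<in> fmeasurable lborel"
  shows "set_integrable lborel A (\<lambda>_. c :: real)" "(LINT x:A|lborel. c) = c * measure lborel A"
  using assms by (auto simp: set_integrable_def set_lebesgue_integral_def fmeasurable_def mult.commute)

lemma measure_arriving_le:
  assumes A: "A \<subseteq> {0..<1}" "A \<in> sets borel" and H: "H \<in> sets borel"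
    and le: "\<And>x. x \<in> A \<Longrightarrow> survivor_density H n x \<le> d"
  shows "measure lborel (arriving H n A) \<le> d * measure lborel A"
proof -
  note f = fmeasurable_unit_subset[OF A]
  have "(LINT x:A|lborel. survivor_density H n x) \<le> (LINT x:A|lborel. d)"
    using set_integral_mono[OF measure_arriving(1)[OF A H, of n] set_integral_const_bound(1)[OF f, of d]] le by simp
  then show ?thesis
    by (simp add: measure_arriving(2)[OF A H] set_integral_const_bound(2)[OF f])
qed

lemma measure_arriving_ge:
  assumes A: "A \<subseteq> {0..<1}" "A \<in> sets borel" and H: "H \<in> sets borel"
    and ge: "\<And>x. x \<in> A \<Longrightarrow> d \<le> survivor_density H n x"
  shows "d * measure lborel A \<le> measure lborel (arriving H n A)"
proof -
  note f = fmeasurable_unit_subset[OF A]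
  have "(LINT x:A|lborel. d) \<le> (LINT x:A|lborel. survivor_density H n x)"
    using set_integral_mono[OF set_integral_const_bound(1)[OF f, of d] measure_arriving(1)[OF A H, of n]] ge by simp
  then show ?thesis
    by (simp add: measure_arriving(2)[OF A H] set_integral_const_bound(2)[OF f])
qed

lemma funpow_unit: "u \<in> {0..<1} \<Longrightarrow> (doubling_map ^^ n) u \<in> {0..<1}"
  by (simp add: funpow_doubling_map frac_lt_1)

lemma survivors_eq_arriving: "survivors H n = arriving H n {0..<1}"
  using funpow_unit[of _ n] by (auto simp: arriving_def survivors_def)

lemma survivors_borel: "H \<in> sets borel \<Longrightarrow> survivors H n \<in> sets borel"
  unfolding survivors_eq_arriving by (rule arriving_borel) auto

lemma survivors_subset: "survivors H n \<subseteq> {0..<1}"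
  by (auto simp: survivors_def)

lemma survivors_add: "survivors H (n + m) = arriving H n (survivors H m)"
proof (intro set_eqI iffI)
  fix u assume u: "u \<in> survivors H (n + m)"
  have "(doubling_map ^^ k) ((doubling_map ^^ n) u) \<notin> H" if "k < m" for k
  proof -
    have "(doubling_map ^^ (k + n)) u \<notin> H" using u that by (auto simp: survivors_def)
    then show ?thesis by (simp add: funpow_add)
  qed
  then show "u \<in> arriving H n (survivors H m)"
    using u funpow_unit[of u n] by (simp add: arriving_def survivors_def)
next
  fix u assume u: "u \<in> arriving H n (survivors H m)"
  have "(doubling_map ^^ k) u \<notin> H" if "k < n + m" for k
  proof (cases "k < n")
    case False
    then have "(doubling_map ^^ (k - n)) ((doubling_map ^^ n) u) \<notin> H"
      using u that by (auto simp: arriving_def survivors_def)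
    moreover have "(doubling_map ^^ (k - n)) ((doubling_map ^^ n) u) = (doubling_map ^^ (k - n + n)) u"
      by (simp only: funpow_add o_apply)
    ultimately show ?thesis using False by simp
  qed (use u in \<open>auto simp: arriving_def survivors_def\<close>)
  then show "u \<in> survivors H (n + m)"
    using u by (auto simp: arriving_def survivors_def)
qed

lemma measure_arriving_le_mass:
  assumes "A \<subseteq> {0..<1}" "A \<in> sets borel" "H \<in> sets borel"
  shows "measure lborel (arriving H n A) \<le> mass H n"
  unfolding mass_def
proof (rule measure_mono_fmeasurable)
  show "arriving H n A \<subseteq> survivors H n" by (auto simp: arriving_def)
  show "arriving H n A \<in> sets lborel" using arriving_borel[OF assms] by simp
  show "survivors H n \<in> fmeasurable lborel"
    using survivors_subset survivors_borel[OF assms(3)] by (rule fmeasurable_unit_subset)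
qed

lemma mass_nonneg: "0 \<le> mass H n"
  by (simp add: mass_def)

lemma mass_0: "mass H 0 = 1"
proof -
  have "survivors H 0 = {0..<1}" by (auto simp: survivors_def)
  then show ?thesis by (simp add: mass_def)
qed

lemma mass_add_le:
  assumes "H \<in> sets borel" "\<And>x. x \<in> {0..<1} \<Longrightarrow> survivor_density H n x \<le> d"
  shows "mass H (n + m) \<le> d * mass H m"
  unfolding mass_def survivors_add
proof (rule measure_arriving_le)
  show "survivor_density H n x \<le> d" if "x \<in> survivors H m" for x
    using assms(2) that survivors_subset by blast
qed (use assms(1) survivors_subset survivors_borel[OF assms(1)] in auto)

lemma mass_Suc:
  assumes "H \<in> sets borel"
  shows "mass H n - mass H (Suc n) = measure lborel (arriving H n (H \<inter> {0..<1}))"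
proof -
  have "survivors H 1 = {0..<1} - H" by (auto simp: survivors_def)
  then have eq: "survivors H (Suc n) = arriving H n ({0..<1} - H)"
    using survivors_add[of H n 1] by simp
  have "survivors H n = arriving H n (H \<inter> {0..<1}) \<union> arriving H n ({0..<1} - H)"
    unfolding survivors_eq_arriving by (auto simp: arriving_def)
  moreover have "measure lborel (arriving H n (H \<inter> {0..<1}) \<union> arriving H n ({0..<1} - H)) =
      measure lborel (arriving H n (H \<inter> {0..<1})) + measure lborel (arriving H n ({0..<1} - H))"
  proof (rule measure_Un_AE)
    show "AE x in lborel. x \<notin> arriving H n (H \<inter> {0..<1}) \<or> x \<notin> arriving H n ({0..<1} - H)"
      by (auto simp: arriving_def)
    show "arriving H n (H \<inter> {0..<1}) \<in> fmeasurable lborel"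
      using assms by (intro fmeasurable_unit_subset arriving_borel) (auto simp: arriving_def survivors_def)
    show "arriving H n ({0..<1} - H) \<in> fmeasurable lborel"
      using assms by (intro fmeasurable_unit_subset arriving_borel) (auto simp: arriving_def survivors_def)
  qed
  ultimately show ?thesis
    by (simp add: mass_def eq)
qed

lemma measure_survivor_set:
  assumes "H \<in> sets borel"
  shows "measure lebesgue (survivor_set H n) = mass H n"
proof -
  define E where "E = survivor_set H n \<inter> {1}"
  have E: "E = {} \<or> E = {1}" by (auto simp: E_def)
  have eq: "survivor_set H n = survivors H n \<union> E"
    by (auto simp: survivor_set_def survivors_def E_def)
  have Eb: "E \<in> null_sets lborel" using E by (auto simp: null_sets_def)
  have b: "survivors H n \<in> sets lborel" using survivors_borel[OF assms] by simp
  have "measure lebesgue (survivor_set H n) = measure lborel (survivor_set H n)"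
    unfolding eq using b Eb by (intro measure_completion) (auto simp: null_sets_def)
  also have "\<dots> = mass H n"
    unfolding eq mass_def measure_def using emeasure_Un_null_set[OF b Eb] by simp
  finally show ?thesis .
qed

section \<open>The survivor density is dominated by the surviving mass\<close>

lemma geometric_tail_le:
  "(\<Sum>l\<in>{L<..n}. (2 / 3) ^ l) \<le> 2 * (2 / 3 :: real) ^ L"
proof (cases "L \<le> n")
  case True
  then have "(\<Sum>l\<in>{L<..n}. (2 / 3) ^ l) = 2 * (2 / 3 :: real) ^ L - 2 * (2 / 3) ^ n"
  proof (induction n rule: dec_induct)
    case (step n)
    have "{L<..Suc n} = insert (Suc n) {L<..n}" using step by auto
    then show ?case using step by simp
  qed simp
  then show ?thesis by simp
qed simp

locale interval_hole =
  fixes H :: "real set"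
  assumes interval: "is_interval H"
begin

text \<open>The point 1 is not in the range of the inverse branches, so only the part of the hole in $[0,1)$
  is counted.\<close>

definition hole_size :: real where
  "hole_size = measure lborel (H \<inter> {0..<1})"

text \<open>The transfer operator only decreases the supremum of the density, but a bound in terms of the
  mass at the same time is what submultiplicativity of the masses and control of the mass lost
  per step require.\<close>

definition dominated :: "real \<Rightarrow> nat \<Rightarrow> bool" where
  "dominated C n \<longleftrightarrow> (\<forall>x\<in>{0..<1}. survivor_density H n x \<le> C * mass H n)"

lemma borel [measurable]: "H \<in> sets borel"
  using interval by (rule real_interval_borel_measurable)

lemma hole_size_nonneg: "0 \<le> hole_size"
  by (simp add: hole_size_def)

lemma mass_Suc_ge:
  assumes "\<And>x. x \<in> H \<inter> {0..<1} \<Longrightarrow> survivor_density H n x \<le> d"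
  shows "mass H n - d * hole_size \<le> mass H (Suc n)"
proof -
  have "measure lborel (arriving H n (H \<inter> {0..<1})) \<le> d * hole_size"
    unfolding hole_size_def using assms borel by (intro measure_arriving_le) auto
  then show ?thesis using mass_Suc[OF borel, of n] by simp
qed

lemma mass_Suc_le:
  assumes "\<And>x. x \<in> H \<inter> {0..<1} \<Longrightarrow> d \<le> survivor_density H n x"
  shows "mass H (Suc n) \<le> mass H n - d * hole_size"
proof -
  have "d * hole_size \<le> measure lborel (arriving H n (H \<inter> {0..<1}))"
    unfolding hole_size_def using assms borel by (intro measure_arriving_ge) auto
  then show ?thesis using mass_Suc[OF borel, of n] by simp
qed

lemma mass_Suc_ge_dominated:
  assumes "dominated C n"
  shows "(1 - C * hole_size) * mass H n \<le> mass H (Suc n)"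
  using mass_Suc_ge[of n "C * mass H n"] assms by (auto simp: dominated_def algebra_simps)

text \<open>Since one step loses at most the fraction \<open>C * hole_size\<close> of a dominated mass, going back \<open>l\<close>
  steps costs only a factor that grows slowly in \<open>l\<close>, and the weights $2^{-l}$ in the comparison
  of densities beat it.\<close>

lemma mass_backward_le:
  assumes "\<And>k. k < n \<Longrightarrow> dominated C k" "C * hole_size < 1" "l \<le> n"
  shows "mass H (n - l) \<le> (1 / (1 - C * hole_size)) ^ l * mass H n"
  using assms(3)
proof (induction l)
  case (Suc l)
  let ?q = "1 - C * hole_size"
  have q: "0 < ?q" using assms(2) by simp
  have "?q * mass H (n - Suc l) \<le> mass H (Suc (n - Suc l))"
    using Suc.prems by (intro mass_Suc_ge_dominated assms(1)) auto
  also have "Suc (n - Suc l) = n - l" using Suc.prems by simp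
  also have "mass H (n - l) \<le> (1 / ?q) ^ l * mass H n" using Suc by simp
  finally have "mass H (n - Suc l) \<le> ((1 / ?q) ^ l * mass H n) / ?q"
    using q by (simp add: pos_le_divide_eq mult.commute)
  then show ?case by simp
qed simp

text \<open>Entry times up to \<open>L\<close> are listed in \<open>D\<close>; the later ones are summed to a geometric tail. The ratio
  2/3 is $\frac{1}{2} \cdot \frac{4}{3}$, where 4/3 bounds the growth of the masses backwards in time.\<close>

lemma survivor_density_comparison_mass:
  assumes dom: "\<And>k. k < n \<Longrightarrow> dominated C k" and C: "0 < C" "C * hole_size \<le> 1 / 4"
    and xy: "x \<in> {0..<1}" "y \<in> {0..<1}"
    and D: "D \<subseteq> {1..n}" "\<And>l. l \<in> {1..L} \<Longrightarrow> entry_branches H l y \<noteq> {} \<Longrightarrow> l \<in> D"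
  shows "survivor_density H n x
    \<le> survivor_density H n y + (\<Sum>l\<in>D. C * mass H (n - l) / 2 ^ l) + 2 * C * (2 / 3) ^ L * mass H n"
proof -
  define f where "f l = C * mass H (n - l) / 2 ^ l" for l
  define R where "R = {l. l \<in> {1..n} \<and> entry_branches H l y \<noteq> {}}"
  have f0: "0 \<le> f l" for l using C(1) mass_nonneg[of H "n - l"] by (simp add: f_def)
  have "survivor_density H n x \<le> survivor_density H n y + (\<Sum>l\<in>R. f l)"
    unfolding R_def f_def
    using dom by (intro survivor_density_comparison[OF interval xy]) (auto simp: dominated_def)
  also have "(\<Sum>l\<in>R. f l) \<le> (\<Sum>l\<in>D \<union> ({L<..n} - D). f l)"
  proof (intro sum_mono2 f0)
    show "finite (D \<union> ({L<..n} - D))" using D(1) finite_subset by auto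
    show "R \<subseteq> D \<union> ({L<..n} - D)"
    proof
      fix l assume l: "l \<in> R"
      then show "l \<in> D \<union> ({L<..n} - D)"
        using D(2)[of l] by (cases "l \<le> L") (auto simp: R_def)
    qed
  qed
  also have "\<dots> = (\<Sum>l\<in>D. f l) + (\<Sum>l\<in>{L<..n} - D. f l)"
    using D(1) finite_subset by (intro sum.union_disjoint) auto
  also have "(\<Sum>l\<in>{L<..n} - D. f l) \<le> (\<Sum>l\<in>{L<..n}. f l)"
    by (intro sum_mono2 f0) auto
  also have "\<dots> \<le> (\<Sum>l\<in>{L<..n}. C * mass H n * (2 / 3) ^ l)"
  proof (rule sum_mono)
    fix l assume l: "l \<in> {L<..n}"
    have "1 / (1 - C * hole_size) \<le> 4 / 3" using C(2) by (simp add: field_simps)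
    then have "(1 / (1 - C * hole_size)) ^ l \<le> (4 / 3) ^ l"
      using C(2) by (intro power_mono) auto
    moreover have "mass H (n - l) \<le> (1 / (1 - C * hole_size)) ^ l * mass H n"
      using C(2) l by (intro mass_backward_le dom) auto
    ultimately have "mass H (n - l) \<le> (4 / 3) ^ l * mass H n"
      using mass_nonneg[of H n] by (meson mult_right_mono order_trans)
    then have "f l \<le> C * ((4 / 3) ^ l * mass H n) / 2 ^ l"
      unfolding f_def using C(1) by (intro divide_right_mono mult_left_mono) auto
    also have "\<dots> = C * mass H n * ((4 / 3) ^ l / 2 ^ l)" by simp
    also have "(4 / 3 :: real) ^ l / 2 ^ l = (2 / 3) ^ l"
      by (simp add: power_divide[symmetric])
    finally show "f l \<le> C * mass H n * (2 / 3) ^ l" .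
  qed
  also have "\<dots> \<le> C * mass H n * (2 * (2 / 3) ^ L)"
    unfolding sum_distrib_left[symmetric]
    using C(1) mass_nonneg[of H n] geometric_tail_le by (intro mult_left_mono) auto
  finally show ?thesis by (simp add: f_def algebra_simps)
qed

text \<open>Starting from the hole, no orbit arrives at an untouched point within \<open>L\<close> steps; such points
  serve as the point of comparison where the density is nearly maximal. Their complement has
  small measure when the hole is small compared with $4^{-L} / L$.\<close>

definition untouched :: "nat \<Rightarrow> real set" where
  "untouched L = {0..<1} - (\<Union>l\<in>{1..L}. \<Union>i<2 ^ l. {y. branch l i y \<in> H \<inter> {0..<1}})"

lemma untouched_no_entry:
  assumes "y \<in> untouched L" "l \<in> {1..L}"
  shows "entry_branches H l y = {}"
  using assms branch_in_unit[of y] by (force simp: untouched_def entry_branches_def)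

lemma branch_preimage:
  shows "{y. branch l i y \<in> H \<inter> {0..<1}} \<in> sets borel"
    and "measure lborel {y. branch l i y \<in> H \<inter> {0..<1}} = 2 ^ l * hole_size"
proof -
  have eq: "{y. branch l i y \<in> H \<inter> {0..<1}} = {y. real i / 2 ^ l + (1 / 2 ^ l) * y \<in> H \<inter> {0..<1}}"
    by (auto simp: branch_def add_divide_distrib add.commute)
  have b: "H \<inter> {0..<1} \<in> sets borel" using borel by auto
  show "{y. branch l i y \<in> H \<inter> {0..<1}} \<in> sets borel"
    unfolding eq by (rule affine_vimage_borel[OF b])
  show "measure lborel {y. branch l i y \<in> H \<inter> {0..<1}} = 2 ^ l * hole_size"
    unfolding eq using measure_lborel_affine_vimage[OF b, of "1 / 2 ^ l" "real i / 2 ^ l"]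
    by (simp add: hole_size_def)
qed

lemma branch_preimage_bounded: "{y. branch l i y \<in> H \<inter> {0..<1}} \<in> fmeasurable lborel"
proof (rule fmeasurableI2[of "{- real i..2 ^ l - real i}"])
  show "{y. branch l i y \<in> H \<inter> {0..<1}} \<subseteq> {- real i..2 ^ l - real i}"
    by (auto simp: branch_def field_simps)
qed (use branch_preimage(1)[of l i] in \<open>auto intro: fmeasurableI\<close>)

lemma untouched_borel: "untouched L \<in> sets borel"
  unfolding untouched_def using branch_preimage(1) by (intro sets.Diff sets.finite_UN) auto

lemma measure_untouched_ge: "1 - real L * 4 ^ L * hole_size \<le> measure lborel (untouched L)"
proof -
  define B where "B l i = {y. branch l i y \<in> H \<inter> {0..<1}}" for l i
  have Bf: "B l i \<in> fmeasurable lborel" for l i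
    unfolding B_def by (rule branch_preimage_bounded)
  have Uf: "(\<Union>i<2 ^ l. B l i) \<in> fmeasurable lborel" for l
    using Bf by (intro fmeasurable.finite_UN) auto
  have "measure lborel (\<Union>l\<in>{1..L}. \<Union>i<2 ^ l. B l i) \<le> (\<Sum>l\<in>{1..L}. measure lborel (\<Union>i<2 ^ l. B l i))"
    using fmeasurableD[OF Uf] by (intro measure_UNION_le) auto
  also have "\<dots> \<le> (\<Sum>l\<in>{1..L}. 4 ^ L * hole_size)"
  proof (rule sum_mono)
    fix l assume l: "l \<in> {1..L}"
    have "measure lborel (\<Union>i<2 ^ l. B l i) \<le> (\<Sum>i<2 ^ l. measure lborel (B l i))"
      using fmeasurableD[OF Bf] by (intro measure_UNION_le) simp_all
    also have "\<dots> = (2 ^ l * 2 ^ l) * hole_size"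
      unfolding B_def branch_preimage(2) by simp
    also have "(2::real) ^ l * 2 ^ l = 4 ^ l" by (simp flip: power_mult_distrib)
    also have "(4::real) ^ l * hole_size \<le> 4 ^ L * hole_size"
      using l hole_size_nonneg by (intro mult_right_mono power_increasing) auto
    finally show "measure lborel (\<Union>i<2 ^ l. B l i) \<le> 4 ^ L * hole_size" .
  qed
  finally have le: "measure lborel (\<Union>l\<in>{1..L}. \<Union>i<2 ^ l. B l i) \<le> real L * 4 ^ L * hole_size" by simp
  have U: "(\<Union>l\<in>{1..L}. \<Union>i<2 ^ l. B l i) \<in> fmeasurable lborel"
    by (intro fmeasurable.finite_UN Bf) auto
  have I: "{0..<1::real} \<in> fmeasurable lborel" by (rule fmeasurable_unit_subset) auto
  have "measure lborel {0..<1::real} \<le> measure lborel (untouched L \<union> (\<Union>l\<in>{1..L}. \<Union>i<2 ^ l. B l i))"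
    using U I by (intro measure_mono_fmeasurable fmeasurable.Un)
      (auto simp: untouched_def B_def)
  also have "\<dots> \<le> measure lborel (untouched L) + measure lborel (\<Union>l\<in>{1..L}. \<Union>i<2 ^ l. B l i)"
    using untouched_borel U by (intro measure_Un_le) auto
  finally show ?thesis using le by simp
qed

text \<open>At every untouched point the density is at least its value at \<open>x\<close> minus a small tail, and the
  untouched points fill almost the whole interval. The average of the density, which is the mass, is
  therefore close to its supremum. The tail involves only earlier times, so the bound propagates by
  induction with the same constant \<open>C\<close>.\<close>

lemma dominated_all:
  assumes C: "0 < C" "C * hole_size \<le> 1 / 4"
    and small: "real L * 4 ^ L * hole_size < 1"
      "1 / (1 - real L * 4 ^ L * hole_size) + 2 * C * (2 / 3) ^ L \<le> C"
  shows "dominated C n"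
proof (induction n rule: less_induct)
  case (less n)
  define k where "k = real L * 4 ^ L * hole_size"
  define t where "t = 2 * C * (2 / 3) ^ L * mass H n"
  show ?case
    unfolding dominated_def
  proof
    fix x :: real assume x: "x \<in> {0..<1}"
    have "survivor_density H n x \<le> mass H n / (1 - k) + t"
    proof (cases "survivor_density H n x \<le> t")
      case True
      then show ?thesis using small(1) mass_nonneg[of H n] by (simp add: k_def add_increasing)
    next
      case False
      have "survivor_density H n x - t \<le> survivor_density H n y" if "y \<in> untouched L" for y
      proof -
        have "y \<in> {0..<1}" using that by (auto simp: untouched_def)
        then have "survivor_density H n x \<le> survivor_density H n y
            + (\<Sum>l\<in>{}. C * mass H (n - l) / 2 ^ l) + 2 * C * (2 / 3) ^ L * mass H n"
          by (intro survivor_density_comparison_mass[OF less.IH C x])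
            (simp_all add: untouched_no_entry[OF that])
        then show ?thesis by (simp add: t_def)
      qed
      then have "(survivor_density H n x - t) * measure lborel (untouched L)
          \<le> measure lborel (arriving H n (untouched L))"
        using untouched_borel borel by (intro measure_arriving_ge) (auto simp: untouched_def)
      also have "\<dots> \<le> mass H n"
        using untouched_borel borel by (intro measure_arriving_le_mass) (auto simp: untouched_def)
      finally have "(survivor_density H n x - t) * (1 - k) \<le> mass H n"
        using measure_untouched_ge[of L] False
        by (smt (verit, best) k_def mult_left_mono)
      then show ?thesis using small(1) by (simp add: k_def field_simps)
    qed
    also have "\<dots> = (1 / (1 - k) + 2 * C * (2 / 3) ^ L) * mass H n"
      by (simp add: t_def algebra_simps)
    also have "\<dots> \<le> C * mass H n"
      using small(2) mass_nonneg[of H n] by (intro mult_right_mono) (auto simp: k_def)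
    finally show "survivor_density H n x \<le> C * mass H n" .
  qed
qed

end

section \<open>Limits of roots\<close>

text \<open>This is Fekete's lemma; the linear lower bound keeps the limit finite.\<close>

lemma subadditive_quotient_convergent:
  fixes b :: "nat \<Rightarrow> real"
  assumes sub: "\<And>m n. b (m + n) \<le> b m + b n"
    and low: "\<And>n. - K * real n \<le> b n"
  shows "convergent (\<lambda>n. b n / real n)"
proof -
  define S where "S = (\<lambda>n. b n / real n) ` {1..}"
  define \<alpha> where "\<alpha> = Inf S"
  have "- K \<le> b n / real n" if "1 \<le> n" for n
    using low[of n] that by (simp add: field_simps)
  then have bdd: "bdd_below S" by (auto simp: S_def intro!: bdd_belowI)
  have lower: "\<alpha> \<le> b n / real n" if "1 \<le> n" for n
    unfolding \<alpha>_def using that by (intro cInf_lower bdd) (auto simp: S_def)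
  have mult: "b (q * k) \<le> real q * b k + b 0" for q k
  proof (induction q)
    case (Suc q)
    then show ?case using sub[of k "q * k"] by (simp add: algebra_simps)
  qed simp
  have "(\<lambda>n. b n / real n) \<longlonglongrightarrow> \<alpha>"
  proof (rule LIMSEQ_I)
    fix r :: real assume r: "0 < r"
    have "S \<noteq> {}" by (auto simp: S_def)
    then obtain s where "s \<in> S" "s < \<alpha> + r / 2"
      using cInf_lessD[of S "\<alpha> + r / 2"] r unfolding \<alpha>_def by auto
    then obtain k where k: "1 \<le> k" "b k / real k < \<alpha> + r / 2" by (auto simp: S_def)
    define c where "c = \<alpha> + r / 2"
    define B where "B = b 0 + (\<Sum>i<k. \<bar>b i\<bar>) + real k * \<bar>c\<bar>"
    have up: "b n \<le> real n * c + B" for n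
    proof -
      define q where "q = n div k"
      define i where "i = n mod k"
      have n: "n = q * k + i" by (simp add: q_def i_def)
      have ik: "i < k" using k(1) by (simp add: i_def)
      have "b n \<le> b (q * k) + b i" unfolding n by (rule sub)
      also have "\<dots> \<le> real q * b k + b 0 + b i" using mult[of q k] by simp
      also have "real q * b k \<le> real q * (real k * c)"
        using k by (intro mult_left_mono) (simp_all add: c_def field_simps)
      also have "real q * (real k * c) = real n * c - real i * c"
        by (simp add: n algebra_simps)
      also have "real n * c - real i * c \<le> real n * c + real k * \<bar>c\<bar>"
      proof -
        have "- (real i * c) \<le> real i * \<bar>c\<bar>" by (metis abs_ge_minus_self abs_mult abs_of_nat)
        also have "\<dots> \<le> real k * \<bar>c\<bar>" using ik by (intro mult_right_mono) auto
        finally show ?thesis by simp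
      qed
      also have "b i \<le> (\<Sum>i<k. \<bar>b i\<bar>)"
        using member_le_sum[of i "{..<k}" "\<lambda>i. \<bar>b i\<bar>"] ik by auto
      finally show ?thesis by (simp add: B_def)
    qed
    have "(\<lambda>n. \<bar>B\<bar> / real n) \<longlonglongrightarrow> 0"
      by (rule lim_const_over_n)
    then have "\<forall>\<^sub>F n in sequentially. \<bar>B\<bar> / real n < r / 2"
      using r by (intro order_tendstoD) auto
    then obtain N where N: "\<And>n. N \<le> n \<Longrightarrow> \<bar>B\<bar> / real n < r / 2"
      by (auto simp: eventually_sequentially)
    have "norm (b n / real n - \<alpha>) < r" if "max 1 N \<le> n" for n
    proof -
      have n: "0 < real n" using that by simp
      have "b n / real n \<le> (real n * c + B) / real n"
        using up[of n] n by (intro divide_right_mono) auto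
      also have "\<dots> = c + B / real n" using n by (simp add: field_simps)
      also have "B / real n \<le> \<bar>B\<bar> / real n" using n by (intro divide_right_mono) auto
      finally have "b n / real n < \<alpha> + r" using N[of n] that unfolding c_def by linarith
      moreover have "\<alpha> \<le> b n / real n" using lower that by simp
      ultimately show ?thesis using r by simp
    qed
    then show "\<exists>no. \<forall>n\<ge>no. norm (b n / real n - \<alpha>) < r" by blast
  qed
  then show ?thesis by (rule convergentI)
qed

lemma root_convergent_if_submultiplicative:
  fixes a :: "nat \<Rightarrow> real"
  assumes C: "0 < C" and sub: "\<And>m n. a (m + n) \<le> C * a m * a n"
    and r: "0 < r" and low: "\<And>n. r ^ n \<le> a n"
  shows "convergent (\<lambda>n. root n (a n))"
proof -
  have pos: "0 < a n" for n using low[of n] r by (meson less_le_trans zero_less_power)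
  define b where "b n = ln C + ln (a n)" for n
  have ba: "b n = ln (C * a n)" for n using C pos[of n] by (simp add: b_def ln_mult)
  have "convergent (\<lambda>n. b n / real n)"
  proof (rule subadditive_quotient_convergent)
    show "b (m + n) \<le> b m + b n" for m n
    proof -
      have "ln (a (m + n)) \<le> ln (C * a m * a n)"
        using sub pos C by (subst ln_le_cancel_iff) auto
      also have "\<dots> = ln C + ln (a m) + ln (a n)" using C pos[of m] pos[of n] by (simp add: ln_mult)
      finally show ?thesis by (simp add: b_def)
    qed
    show "- (\<bar>ln r\<bar> + \<bar>ln C\<bar>) * real n \<le> b n" for n
    proof (cases "n = 0")
      case True
      have "a 0 \<le> C * a 0 * a 0" using sub[of 0 0] by simp
      then have "1 \<le> C * a 0" using pos[of 0] by simp
      then show ?thesis using True by (simp add: ba)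
    next
      case False
      have "real n * ln r \<le> ln (a n)"
        using low[of n] r pos[of n] by (metis ln_realpow ln_le_cancel_iff zero_less_power)
      moreover have "- \<bar>ln r\<bar> * real n \<le> real n * ln r"
        by (metis abs_ge_minus_self abs_minus_cancel minus_le_iff mult.commute mult_left_mono of_nat_0_le_iff)
      moreover have "- \<bar>ln C\<bar> * real n \<le> ln C"
      proof -
        have "\<bar>ln C\<bar> * 1 \<le> \<bar>ln C\<bar> * real n" using False by (intro mult_left_mono) auto
        then show ?thesis by (simp; linarith)
      qed
      ultimately show ?thesis by (simp add: b_def algebra_simps)
    qed
  qed
  then obtain l where l: "(\<lambda>n. b n / real n) \<longlonglongrightarrow> l" by (auto simp: convergent_def)
  have "(\<lambda>n. exp (b n / real n - ln C / real n)) \<longlonglongrightarrow> exp (l - 0)"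
    by (intro tendsto_exp tendsto_diff l lim_const_over_n)
  moreover have "\<forall>\<^sub>F n in sequentially. exp (b n / real n - ln C / real n) = root n (a n)"
    using eventually_gt_at_top[of 0]
  proof eventually_elim
    case (elim n)
    have "root n (a n) = exp (ln (a n) / real n)"
      using pos[of n] elim by (metis exp_ln ln_root real_root_gt_0_iff)
    then show ?case by (simp add: b_def diff_divide_distrib[symmetric])
  qed
  ultimately have "(\<lambda>n. root n (a n)) \<longlonglongrightarrow> exp (l - 0)"
    using tendsto_cong by fast
  then show ?thesis by (rule convergentI)
qed

lemma tendsto_root_geometric:
  assumes "0 < c" "0 < r"
  shows "(\<lambda>n. root n (c * r ^ n)) \<longlonglongrightarrow> r"
proof -
  have "(\<lambda>n. root n c * r) \<longlonglongrightarrow> 1 * r"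
    by (intro tendsto_mult LIMSEQ_root_const assms tendsto_const)
  moreover have "\<forall>\<^sub>F n in sequentially. root n c * r = root n (c * r ^ n)"
    using eventually_gt_at_top[of 0]
    by eventually_elim (use assms in \<open>simp add: real_root_mult real_root_power_cancel\<close>)
  ultimately show ?thesis using tendsto_cong by fastforce
qed

lemma root_limit_ge:
  fixes a :: "nat \<Rightarrow> real"
  assumes lim: "(\<lambda>n. root n (a n)) \<longlonglongrightarrow> l" and "0 < a N" "0 < r"
    and ge: "\<And>n. N \<le> n \<Longrightarrow> r * a n \<le> a (Suc n)"
  shows "r \<le> l"
proof -
  have *: "a N / r ^ N * r ^ n \<le> a n" if "N \<le> n" for n
    using that
  proof (induction n rule: dec_induct)
    case (step n)
    have "r * (a N / r ^ N * r ^ n) \<le> r * a n" using step assms(3) by (intro mult_left_mono) auto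
    also have "\<dots> \<le> a (Suc n)" using step by (intro ge) auto
    finally show ?case by (simp add: mult_ac)
  qed (use assms in simp)
  show ?thesis
  proof (rule tendsto_le[OF _ lim tendsto_root_geometric[of "a N / r ^ N" r]])
    show "\<forall>\<^sub>F n in sequentially. root n (a N / r ^ N * r ^ n) \<le> root n (a n)"
      using eventually_ge_at_top[of "max 1 N"] by eventually_elim (use * in auto)
  qed (use assms in auto)
qed

lemma root_limit_le:
  fixes a :: "nat \<Rightarrow> real"
  assumes lim: "(\<lambda>n. root n (a n)) \<longlonglongrightarrow> l" and "0 < a N" "0 < r"
    and le: "\<And>n. N \<le> n \<Longrightarrow> a (Suc n) \<le> r * a n"
  shows "l \<le> r"
proof -
  have *: "a n \<le> a N / r ^ N * r ^ n" if "N \<le> n" for n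
    using that
  proof (induction n rule: dec_induct)
    case (step n)
    have "a (Suc n) \<le> r * a n" using step by (intro le) auto
    also have "\<dots> \<le> r * (a N / r ^ N * r ^ n)" using step assms(3) by (intro mult_left_mono) auto
    finally show ?case by (simp add: mult_ac)
  qed (use assms in simp)
  show ?thesis
  proof (rule tendsto_le[OF _ tendsto_root_geometric[of "a N / r ^ N" r] lim])
    show "\<forall>\<^sub>F n in sequentially. root n (a n) \<le> root n (a N / r ^ N * r ^ n)"
      using eventually_ge_at_top[of "max 1 N"] by eventually_elim (use * in auto)
  qed (use assms in auto)
qed

section \<open>Returns to an interval around a periodic point\<close>

lemma periodic_point_in_unit:
  assumes "has_minimal_period doubling_map z p"
  shows "z \<in> {0..<1}"
proof -
  obtain m where "p = Suc m" "(doubling_map ^^ p) z = z"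
    using assms by (metis gr0_implies_Suc has_minimal_period_def)
  then have "z = doubling_map ((doubling_map ^^ m) z)" by simp
  then have "z = frac (2 * (doubling_map ^^ m) z)" by (simp add: doubling_map_def)
  then show ?thesis by (metis atLeastLessThan_iff frac_ge_0 frac_lt_1)
qed

lemma periodic_branch:
  assumes "has_minimal_period doubling_map z p"
  obtains i where "i < 2 ^ p" "branch p i z = z"
proof -
  have z: "z \<in> {0..<1}" by (rule periodic_point_in_unit[OF assms])
  define i where "i = nat \<lfloor>2 ^ p * z\<rfloor>"
  have ir: "real i = of_int \<lfloor>2 ^ p * z\<rfloor>" using z by (simp add: i_def)
  have "frac (2 ^ p * z) = z"
    using assms funpow_doubling_map[OF z, of p] by (simp add: has_minimal_period_def)
  then have "2 ^ p * z = z + real i" unfolding ir by (simp add: frac_def)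
  then have b: "branch p i z = z" by (simp add: branch_def field_simps)
  have "real i \<le> 2 ^ p * z" unfolding ir by simp
  also have "\<dots> < 2 ^ p" using z by simp
  finally have "i < 2 ^ p" by (metis of_nat_less_iff of_nat_numeral of_nat_power)
  then show thesis using b that by blast
qed

text \<open>The branch contracts towards its fixed point, so it maps an interval around that point into itself.\<close>

lemma branch_towards_fixed_point:
  assumes "is_interval H" "z \<in> H" "y \<in> H" "branch l i z = z"
  shows "branch l i y \<in> H"
proof -
  have "branch l i y = z + (y - z) / 2 ^ l"
    using assms(4) by (simp add: branch_def field_simps)
  also have "\<dots> = (1 - 1 / 2 ^ l) *\<^sub>R z + (1 / 2 ^ l) *\<^sub>R y"
    by (simp add: field_simps)
  also have "\<dots> \<in> H"
    using assms by (intro convexD is_interval_convex) auto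
  finally show ?thesis .
qed

text \<open>A small interval returns to itself at time \<open>l \<le> L\<close> only along a branch that fixes \<open>z\<close>: otherwise
  the finitely many numbers $(2^l - 1) z - i$ are bounded away from 0. Then \<open>l\<close> is a multiple of
  \<open>p\<close>, and for a proper multiple the contraction towards \<open>z\<close> forces a visit to the hole \<open>p\<close> steps before
  the end, so that \<open>l\<close> is not an entry time.\<close>

lemma entry_near_periodic_point:
  assumes H: "is_interval H" "z \<in> H" and per: "has_minimal_period doubling_map z p"
    and diam: "\<And>u v. u \<in> H \<Longrightarrow> v \<in> H \<Longrightarrow> \<bar>u - v\<bar> \<le> e"
    and sep: "\<And>l i. l \<in> {1..L} \<Longrightarrow> i < 2 ^ l \<Longrightarrow> branch l i z \<noteq> z \<Longrightarrow>
        (2 ^ l + 1) * e < \<bar>(2 ^ l - 1) * z - real i\<bar>"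
    and y: "y \<in> H" and l: "l \<in> {1..L}" and entry: "entry_branches H l y \<noteq> {}"
  shows "l = p"
proof (rule ccontr)
  assume "l \<noteq> p"
  have z: "z \<in> {0..<1}" by (rule periodic_point_in_unit[OF per])
  have pz: "(doubling_map ^^ p) z = z" and p: "0 < p"
    and minimal: "\<And>q. 0 < q \<Longrightarrow> q < p \<Longrightarrow> (doubling_map ^^ q) z \<noteq> z"
    using per by (auto simp: has_minimal_period_def)
  obtain i where i: "i < 2 ^ l" "branch l i y \<in> H" "\<And>m. m \<in> {1..<l} \<Longrightarrow> branch m (i mod 2 ^ m) y \<notin> H"
    using entry by (auto simp: entry_branches_def)
  define u where "u = branch l i y"
  have "(2 ^ l - 1) * z - real i = (y - z) - 2 ^ l * (u - z)"
    by (simp add: u_def branch_def field_simps)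
  also have "\<bar>\<dots>\<bar> \<le> \<bar>y - z\<bar> + 2 ^ l * \<bar>u - z\<bar>"
    using abs_triangle_ineq4[of "y - z" "2 ^ l * (u - z)"] by (simp add: abs_mult)
  also have "\<dots> \<le> e + 2 ^ l * e"
    using diam[OF y H(2)] diam[of u z] i(2) H(2) by (intro add_mono mult_left_mono) (auto simp: u_def)
  finally have fixed: "branch l i z = z"
    using sep[OF l i(1)] by (force simp: algebra_simps)
  then have "(doubling_map ^^ l) z = z"
    using funpow_branch[OF z i(1), of l] by (simp add: branch_def)
  then have "(doubling_map ^^ (l mod p)) z = z"
    using funpow_mod_eq[OF pz, of l] by simp
  then have "l mod p = 0" using minimal[of "l mod p"] p by (meson mod_less_divisor neq0_conv)
  then have "p \<le> l" using l by (intro dvd_imp_le) auto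
  then have pl: "p < l" using \<open>l \<noteq> p\<close> by simp
  have "(l - p) mod p = 0" using \<open>l mod p = 0\<close> \<open>p \<le> l\<close> by (simp add: le_mod_geq)
  then have "(doubling_map ^^ (l - p)) z = z"
    using funpow_mod_eq[OF pz, of "l - p"] by simp
  then have "branch p (i mod 2 ^ p) z = z"
    using funpow_branch[OF z i(1), of "l - p"] fixed pl by simp
  then have "branch p (i mod 2 ^ p) y \<in> H"
    by (rule branch_towards_fixed_point[OF H y])
  then show False using i(3)[of p] pl p by simp
qed

section \<open>The decay rate\<close>

lemma (in interval_hole) mass_ge_power:
  assumes "\<And>n. dominated C n" "C * hole_size \<le> 1"
  shows "(1 - C * hole_size) ^ n \<le> mass H n"
proof (induction n)
  case (Suc n)
  have "(1 - C * hole_size) * (1 - C * hole_size) ^ n \<le> (1 - C * hole_size) * mass H n"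
    using Suc assms(2) by (intro mult_left_mono) auto
  also have "\<dots> \<le> mass H (Suc n)" by (rule mass_Suc_ge_dominated[OF assms(1)])
  finally show ?case by simp
qed (simp add: mass_0)

lemma (in interval_hole) convergent_root_mass:
  assumes dom: "\<And>n. dominated C n" and C: "0 < C" "C * hole_size < 1"
  shows "convergent (\<lambda>n. root n (mass H n))"
proof (rule root_convergent_if_submultiplicative[of C _ "1 - C * hole_size"])
  show "mass H (m + n) \<le> C * mass H m * mass H n" for m n
    using dom[of m] by (intro mass_add_le borel) (auto simp: dominated_def)
qed (use assms mass_ge_power in auto)

text \<open>On the hole the branch that fixes the periodic point is lost, which gives the upper bound. The lower
  bound comes from comparison with an arbitrary point: \<open>p\<close> is the only entry time up to \<open>L\<close>, so the
  density at \<open>y\<close> lacks at most the fraction $2^{-p}$ and a small tail.\<close>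

lemma (in interval_hole) survivor_density_on_hole:
  assumes dom: "\<And>n. dominated C n" and C: "0 < C" "C * hole_size \<le> 1 / 4"
    and p: "0 < p" "p \<le> n" and i: "i < 2 ^ p" "branch p i y \<in> H"
    and entry: "\<And>l. l \<in> {1..L} \<Longrightarrow> entry_branches H l y \<noteq> {} \<Longrightarrow> l = p"
    and y: "y \<in> {0..<1}"
  defines "Q \<equiv> C * (1 / (1 - C * hole_size)) ^ p"
  shows "survivor_density H n y \<le> (1 - 1 / 2 ^ p) * Q * mass H n"
    and "(1 - Q / 2 ^ p - 2 * C * (2 / 3) ^ L) * mass H n \<le> survivor_density H n y"
proof -
  have "mass H (n - p) \<le> (1 / (1 - C * hole_size)) ^ p * mass H n"
    using C p by (intro mass_backward_le dom) auto
  then have mass_back: "C * mass H (n - p) \<le> Q * mass H n"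
    using C(1) by (simp add: Q_def)
  have "survivor_density H n y \<le> (1 - 1 / 2 ^ p) * (C * mass H (n - p))"
    using dom[of "n - p"] by (intro survivor_density_le_omitting_branch[OF y p(2) i p(1)]) (auto simp: dominated_def)
  also have "\<dots> \<le> (1 - 1 / 2 ^ p) * (Q * mass H n)"
    using mass_back by (intro mult_left_mono) auto
  finally show "survivor_density H n y \<le> (1 - 1 / 2 ^ p) * Q * mass H n" by (simp add: mult_ac)
  define d where "d = survivor_density H n y + Q * mass H n / 2 ^ p + 2 * C * (2 / 3) ^ L * mass H n"
  have "survivor_density H n x \<le> d" if x: "x \<in> {0..<1}" for x
  proof -
    have "survivor_density H n x \<le> survivor_density H n y + (\<Sum>l\<in>{p}. C * mass H (n - l) / 2 ^ l)
        + 2 * C * (2 / 3) ^ L * mass H n"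
      using p entry by (intro survivor_density_comparison_mass[OF dom C x y]) auto
    also have "\<dots> \<le> d"
      using mass_back by (simp add: d_def divide_right_mono)
    finally show ?thesis .
  qed
  then have "measure lborel (arriving H n {0..<1}) \<le> d * measure lborel {0..<1::real}"
    by (intro measure_arriving_le borel) auto
  then have "mass H n \<le> d"
    by (simp add: mass_def survivors_eq_arriving[symmetric])
  then show "(1 - Q / 2 ^ p - 2 * C * (2 / 3) ^ L) * mass H n \<le> survivor_density H n y"
    by (simp add: d_def algebra_simps)
qed

lemma (in interval_hole) decay_rate_bounds:
  assumes dom: "\<And>n. dominated C n" and C: "0 < C" "C * hole_size \<le> 1 / 4"
    and p: "0 < p" and i: "i < 2 ^ p" "\<And>y. y \<in> H \<Longrightarrow> branch p i y \<in> H"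
    and entry: "\<And>l y. y \<in> H \<Longrightarrow> l \<in> {1..L} \<Longrightarrow> entry_branches H l y \<noteq> {} \<Longrightarrow> l = p"
    and \<theta>: "(1 - 1 / 2 ^ p) * (C * (1 / (1 - C * hole_size)) ^ p) \<le> \<theta>\<^sub>1"
      "\<theta>\<^sub>2 \<le> 1 - C * (1 / (1 - C * hole_size)) ^ p / 2 ^ p - 2 * C * (2 / 3) ^ L"
      "\<theta>\<^sub>1 * hole_size < 1" "\<theta>\<^sub>2 * hole_size < 1"
  shows "convergent (survival_root H)" and "decay_rate H \<in> {1 - \<theta>\<^sub>1 * hole_size..1 - \<theta>\<^sub>2 * hole_size}"
proof -
  have eq: "survival_root H = (\<lambda>n. root n (mass H n))"
    by (simp add: fun_eq_iff survival_root_def measure_survivor_set[OF borel])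
  show conv: "convergent (survival_root H)"
    unfolding eq using dom C by (intro convergent_root_mass[of C]) auto
  then have lim: "(\<lambda>n. root n (mass H n)) \<longlonglongrightarrow> decay_rate H"
    unfolding eq decay_rate_def by (simp add: convergent_LIMSEQ_iff)
  have "(0::real) < (1 - C * hole_size) ^ p" using C(2) by simp
  also have "\<dots> \<le> mass H p" using mass_ge_power[OF dom] C(2) by simp
  finally have pos: "0 < mass H p" .
  have "1 - \<theta>\<^sub>1 * hole_size \<le> decay_rate H"
  proof (rule root_limit_ge[OF lim pos])
    fix n assume n: "p \<le> n"
    have "survivor_density H n x \<le> \<theta>\<^sub>1 * mass H n" if "x \<in> H \<inter> {0..<1}" for x
    proof (rule order_trans[OF survivor_density_on_hole(1)[OF dom C p n i(1), where L = L]])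
      show "(1 - 1 / 2 ^ p) * (C * (1 / (1 - C * hole_size)) ^ p) * mass H n \<le> \<theta>\<^sub>1 * mass H n"
        by (intro mult_right_mono \<theta> mass_nonneg)
    qed (use that i entry in auto)
    then show "(1 - \<theta>\<^sub>1 * hole_size) * mass H n \<le> mass H (Suc n)"
      using mass_Suc_ge[of n "\<theta>\<^sub>1 * mass H n"] by (simp add: algebra_simps)
  qed (use \<theta> in auto)
  moreover have "decay_rate H \<le> 1 - \<theta>\<^sub>2 * hole_size"
  proof (rule root_limit_le[OF lim pos])
    fix n assume n: "p \<le> n"
    have "\<theta>\<^sub>2 * mass H n \<le> survivor_density H n x" if "x \<in> H \<inter> {0..<1}" for x
    proof (rule order_trans[OF _ survivor_density_on_hole(2)[OF dom C p n i(1), where L = L]])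
      show "\<theta>\<^sub>2 * mass H n
          \<le> (1 - C * (1 / (1 - C * hole_size)) ^ p / 2 ^ p - 2 * C * (2 / 3) ^ L) * mass H n"
        by (intro mult_right_mono \<theta> mass_nonneg)
    qed (use that i entry in auto)
    then show "mass H (Suc n) \<le> (1 - \<theta>\<^sub>2 * hole_size) * mass H n"
      using mass_Suc_le[of "\<theta>\<^sub>2 * mass H n" n] by (simp add: algebra_simps)
  qed (use \<theta> in auto)
  ultimately show "decay_rate H \<in> {1 - \<theta>\<^sub>1 * hole_size..1 - \<theta>\<^sub>2 * hole_size}" by simp
qed

lemma (in interval_hole) hole_size_eq_lebesgue:
  assumes "H \<subseteq> {0..1}"
  shows "hole_size = measure lebesgue H"
proof -
  have "measure lborel (H \<inter> {0..<1}) = measure lborel H"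
  proof (rule measure_eq_AE)
    have "AE x in lborel. x \<noteq> (1::real)" by (rule AE_lborel_singleton)
    then show "AE x in lborel. x \<in> H \<inter> {0..<1} \<longleftrightarrow> x \<in> H"
      by eventually_elim (use assms in force)
  qed (use borel in auto)
  then show ?thesis using borel by (simp add: hole_size_def)
qed

lemma interval_diameter_le:
  fixes H :: "real set"
  assumes "is_interval H" "H \<subseteq> {0..1}" "u \<in> H" "v \<in> H"
  shows "\<bar>u - v\<bar> \<le> measure lebesgue H"
proof -
  have b: "H \<in> sets borel" using assms(1) by (rule real_interval_borel_measurable)
  have "{min u v..max u v} \<subseteq> H"
  proof
    fix w assume "w \<in> {min u v..max u v}"
    then have "u \<le> w \<and> w \<le> v \<or> v \<le> w \<and> w \<le> u" by (simp add: min_le_iff_disj le_max_iff_disj) linarith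
    then show "w \<in> H" using assms(1,3,4) unfolding is_interval_1 by blast
  qed
  moreover have "H \<in> fmeasurable lborel"
    by (rule fmeasurableI2[of "{0..1}"]) (use assms(2) b in \<open>auto intro: fmeasurableI\<close>)
  ultimately have "measure lborel {min u v..max u v} \<le> measure lborel H"
    by (intro measure_mono_fmeasurable) auto
  moreover have "measure lborel {min u v..max u v} = \<bar>u - v\<bar>"
    by (cases "u \<le> v") auto
  ultimately show ?thesis using b by simp
qed

lemma eventually_separated:
  "\<forall>\<^sub>F e in at_right 0. \<forall>l\<in>{1..L}. \<forall>i\<in>{..<2 ^ l}. branch l i z \<noteq> z \<longrightarrow>
     (2 ^ l + 1) * e < \<bar>(2 ^ l - 1) * z - real i\<bar>"
proof (intro eventually_ball_finite ballI)
  fix l i :: nat assume l: "l \<in> {1..L}"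
  show "\<forall>\<^sub>F e in at_right 0. branch l i z \<noteq> z \<longrightarrow> (2 ^ l + 1) * e < \<bar>(2 ^ l - 1) * z - real i\<bar>"
  proof (cases "branch l i z = z")
    case False
    then have "0 < \<bar>(2 ^ l - 1) * z - real i\<bar>" by (auto simp: branch_def field_simps)
    moreover have "((\<lambda>e. (2 ^ l + 1) * e) \<longlongrightarrow> (0::real)) (at_right 0)"
      by (auto intro!: tendsto_eq_intros)
    ultimately have "\<forall>\<^sub>F e in at_right 0. (2 ^ l + 1) * e < \<bar>(2 ^ l - 1) * z - real i\<bar>"
      by (intro order_tendstoD)
    then show ?thesis by (rule eventually_mono) simp
  qed simp
qed auto

text \<open>Three parameters are fixed in turn: \<open>C\<close> close to 1, then the horizon \<open>L\<close> so large that the tail is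
  smaller than \<open>C - 1\<close>, and then \<open>\<epsilon>\<close> small depending on both.\<close>

lemma eventually_decay_rate_estimate:
  fixes I :: "real \<Rightarrow> real set" and \<delta> :: real
  assumes per: "has_minimal_period doubling_map z p"
    and I: "\<forall>\<^sub>F \<epsilon> in at_right 0.
           is_interval (I \<epsilon>) \<and> I \<epsilon> \<subseteq> {0..1} \<and> measure lebesgue (I \<epsilon>) = \<epsilon> \<and> z \<in> I \<epsilon>"
    and \<delta>: "0 < \<delta>"
  shows "\<forall>\<^sub>F \<epsilon> in at_right 0. convergent (survival_root (I \<epsilon>)) \<and>
           \<bar>decay_rate (I \<epsilon>) - (1 - \<epsilon> * (1 - 1 / 2 ^ p))\<bar> \<le> \<delta> * \<epsilon>"
proof -
  define \<theta> :: real where "\<theta> = 1 - 1 / 2 ^ p"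
  define C where "C = 1 + \<delta> / 4"
  have C: "1 < C" "0 < C" using \<delta> by (auto simp: C_def)
  have p: "0 < p" using per by (simp add: has_minimal_period_def)
  obtain i where i: "i < 2 ^ p" "branch p i z = z" using periodic_branch[OF per] .
  have "(\<lambda>L. 2 * C * (2 / 3) ^ L) \<longlonglongrightarrow> 2 * C * 0"
    by (intro tendsto_mult tendsto_const LIMSEQ_realpow_zero) auto
  then have "\<forall>\<^sub>F L in sequentially. 2 * C * (2 / 3) ^ L < \<delta> / 4"
    using \<delta> by (intro order_tendstoD) auto
  then obtain L where L: "2 * C * (2 / 3) ^ L < \<delta> / 4"
    by (auto simp: eventually_sequentially)
  have half: "0 < 1 / (2::real) ^ p" "1 / (2::real) ^ p \<le> 1" by auto
  have e1: "\<forall>\<^sub>F e in at_right 0. C * e < 1 / 4"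
    by (rule order_tendstoD(2)[where y = 0]) (auto intro!: tendsto_eq_intros)
  have e2: "\<forall>\<^sub>F e in at_right 0. real L * 4 ^ L * e < 1"
    by (rule order_tendstoD(2)[where y = 0]) (auto intro!: tendsto_eq_intros)
  have e3: "\<forall>\<^sub>F e in at_right 0. 1 / (1 - real L * 4 ^ L * e) + 2 * C * (2 / 3) ^ L < C"
    by (rule order_tendstoD(2)[where y = "1 + 2 * C * (2 / 3) ^ L"])
      (use L in \<open>auto intro!: tendsto_eq_intros simp: C_def\<close>)
  have "\<theta> * C < \<theta> + \<delta>"
  proof -
    have "\<theta> * (\<delta> / 4) \<le> 1 * (\<delta> / 4)" using \<delta> half by (intro mult_right_mono) (auto simp: \<theta>_def)
    then show ?thesis using \<delta> by (simp add: C_def algebra_simps)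
  qed
  then have e4: "\<forall>\<^sub>F e in at_right 0. \<theta> * (C * (1 / (1 - C * e)) ^ p) < \<theta> + \<delta>"
    by (intro order_tendstoD(2)[where y = "\<theta> * C"]) (auto intro!: tendsto_eq_intros)
  have "\<theta> - \<delta> < 1 - C / 2 ^ p - 2 * C * (2 / 3) ^ L"
  proof -
    have "\<delta> / 4 * (1 / 2 ^ p) \<le> \<delta> / 4 * 1" using \<delta> half by (intro mult_left_mono) auto
    moreover have "C / 2 ^ p = 1 / 2 ^ p + \<delta> / 4 * (1 / 2 ^ p)" by (simp add: C_def field_simps)
    ultimately show ?thesis using L \<delta> by (simp add: \<theta>_def)
  qed
  then have e5: "\<forall>\<^sub>F e in at_right 0.
      \<theta> - \<delta> < 1 - C * (1 / (1 - C * e)) ^ p / 2 ^ p - 2 * C * (2 / 3) ^ L"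
    by (intro order_tendstoD(1)[where y = "1 - C / 2 ^ p - 2 * C * (2 / 3) ^ L"])
      (auto intro!: tendsto_eq_intros)
  have e6: "\<forall>\<^sub>F e in at_right 0. (\<theta> + \<delta>) * e < 1"
    by (rule order_tendstoD(2)[where y = 0]) (auto intro!: tendsto_eq_intros)
  have e7: "\<forall>\<^sub>F e in at_right 0. (\<theta> - \<delta>) * e < 1"
    by (rule order_tendstoD(2)[where y = 0]) (auto intro!: tendsto_eq_intros)
  from I e1 e2 e3 e4 e5 e6 e7 eventually_separated[of L z]
  show ?thesis
  proof eventually_elim
    case (elim \<epsilon>)
    interpret interval_hole "I \<epsilon>" by unfold_locales (use elim in simp)
    have s: "hole_size = \<epsilon>" using hole_size_eq_lebesgue elim by simp
    have dom: "dominated C n" for n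
      using elim C by (intro dominated_all[of C L]) (auto simp: s)
    have entry: "l = p" if "y \<in> I \<epsilon>" "l \<in> {1..L}" "entry_branches (I \<epsilon>) l y \<noteq> {}" for l y
    proof (rule entry_near_periodic_point[OF interval _ per _ _ that])
      show "\<bar>u - v\<bar> \<le> \<epsilon>" if "u \<in> I \<epsilon>" "v \<in> I \<epsilon>" for u v
        using interval_diameter_le[OF interval _ that] elim by simp
    qed (use elim in auto)
    have inner: "branch p i y \<in> I \<epsilon>" if "y \<in> I \<epsilon>" for y
      using elim by (intro branch_towards_fixed_point[OF interval _ that i(2)]) simp
    have hyps: "C * hole_size \<le> 1 / 4"
      "(1 - 1 / 2 ^ p) * (C * (1 / (1 - C * hole_size)) ^ p) \<le> \<theta> + \<delta>"
      "\<theta> - \<delta> \<le> 1 - C * (1 / (1 - C * hole_size)) ^ p / 2 ^ p - 2 * C * (2 / 3) ^ L"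
      "(\<theta> + \<delta>) * hole_size < 1" "(\<theta> - \<delta>) * hole_size < 1"
      using elim by (simp_all add: s \<theta>_def)
    note bounds = decay_rate_bounds[OF dom C(2) hyps(1) p i(1) inner entry hyps(2-5)]
    have "decay_rate (I \<epsilon>) \<in> {1 - (\<theta> + \<delta>) * \<epsilon>..1 - (\<theta> - \<delta>) * \<epsilon>}"
      using bounds(2) by (simp add: s)
    then have "\<bar>decay_rate (I \<epsilon>) - (1 - \<epsilon> * \<theta>)\<bar> \<le> \<delta> * \<epsilon>"
      by (simp add: abs_le_iff algebra_simps)
    then show ?case using bounds(1) by (simp add: \<theta>_def)
  qed
qed

theorem mainTheorem2:
  fixes z :: real and p :: nat and I :: "real \<Rightarrow> real set"
  assumes "z \<in> {0..1}"
    and "has_minimal_period doubling_map z p"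
    and "\<forall>\<^sub>F \<epsilon> in at_right 0.
           is_interval (I \<epsilon>) \<and> I \<epsilon> \<subseteq> {0..1} \<and> measure lebesgue (I \<epsilon>) = \<epsilon> \<and> z \<in> I \<epsilon>"
  shows "(\<forall>\<^sub>F \<epsilon> in at_right 0. convergent (survival_root (I \<epsilon>))) \<and>
         (\<lambda>\<epsilon>. decay_rate (I \<epsilon>) - (1 - \<epsilon> * (1 - 1 / 2 ^ p))) \<in> o[at_right 0](\<lambda>\<epsilon>. \<epsilon>)"
proof
  note estimate = eventually_decay_rate_estimate[OF assms(2,3)]
  show "\<forall>\<^sub>F \<epsilon> in at_right 0. convergent (survival_root (I \<epsilon>))"
    by (rule eventually_mono[OF estimate[of 1]]) simp_all
  show "(\<lambda>\<epsilon>. decay_rate (I \<epsilon>) - (1 - \<epsilon> * (1 - 1 / 2 ^ p))) \<in> o[at_right 0](\<lambda>\<epsilon>. \<epsilon>)"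
  proof (rule landau_o.smallI)
    fix c :: real assume "c > 0"
    from estimate[OF this] eventually_at_right_less[of 0]
    show "\<forall>\<^sub>F \<epsilon> in at_right 0. norm (decay_rate (I \<epsilon>) - (1 - \<epsilon> * (1 - 1 / 2 ^ p))) \<le> c * norm \<epsilon>"
      by eventually_elim simp
  qed
qed

end
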